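(* Suppose $c$ is such that Quadtree is guaranteed, for any dataset of $n$ distributions and any query, to return a $c$-approximate nearest neighbor (i.e., the nearest neighbor of the query in the Quadtree distance is a $c$-approximate nearest neighbor in the $W_1$ distance) with probability more than $1/2$. Then $c=\Omega(\log n)$.
   Context: Setting: $X\subset\mathbb{R}^d$ is a finite ground set; dataset distributions $\mu_1,\ldots,\mu_n$ and a query $\nu$ are probability distributions on $X$. $W_1(\mu,\nu)=\min_\tau\sum_{x_1,x_2}\tau(x_1,x_2)d_X(x_1,x_2)$ over couplings $\tau$ of $\mu,\nu$, with $d_X$ the underlying metric on $X$. A distribution $\mu_i$ is a $c$-approximate nearest neighbor of $\nu$ if $W_1(\mu_i,\nu)\le c\cdot\min_j W_1(\mu_j,\nu)$. Quadtree: $X$ is scaled so that the minimum pairwise distance is $1$ and shifted to have coordinates in $[0,\Phi]$; with $\sigma$ having i.i.d. uniform coordinates in $[0,\Phi]$, the root is the hypercube $[-\Phi,\Phi]^d+\sigma$, each hypercube is recursively halved along every dimension, keeping only non-empty sub-hypercubes and stopping at hypercubes containing a single point. Levels are numbered from $\log\Phi+1$ at the root downward, and an edge from level $\ell+1$ to level $\ell$ has weight $2^\ell$. The Quadtree distance between distributions is the Wasserstein-1 distance with respect to the resulting tree metric on $X$, and Quadtree returns the dataset distribution nearest to the query in this distance. *)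

theory Defs
  imports
    "HOL-Probability.Probability"
    "HOL-Library.Landau_Symbols"
    "Graph_Theory.Shortest_Path"
begin

text \<open>
  The dimension \<open>d\<close> has to be quantified over inside the approximation guarantee, so a point of
  \<open>\<real>\<^sup>d\<close> is an extensional function on \<open>{..<d}\<close>.
\<close>

type_synonym point = "nat \<Rightarrow> real"

definition lp_dist :: "real \<Rightarrow> nat \<Rightarrow> point \<Rightarrow> point \<Rightarrow> real" where
  "lp_dist p d x y = (\<Sum>i<d. \<bar>x i - y i\<bar> powr p) powr (1 / p)"

lemma lp_dist_manhattan: "lp_dist 1 d x y = (\<Sum>i<d. \<bar>x i - y i\<bar>)"
  by (simp add: lp_dist_def sum_nonneg)

lemma lp_dist_euclidean: "lp_dist 2 d x y = sqrt (\<Sum>i<d. (x i - y i)\<^sup>2)"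
  by (simp add: lp_dist_def powr_half_sqrt sum_nonneg)

definition ground_set :: "real \<Rightarrow> nat \<Rightarrow> real \<Rightarrow> point set \<Rightarrow> bool" where
  "ground_set p d \<Phi> X \<longleftrightarrow>
     finite X \<and> X \<noteq> {} \<and> X \<subseteq> {..<d} \<rightarrow>\<^sub>E {0..\<Phi>} \<and>
     (card X \<ge> 2 \<longrightarrow> Min {lp_dist p d x y | x y. x \<in> X \<and> y \<in> X \<and> x \<noteq> y} = 1)"

definition couplings :: "'a pmf \<Rightarrow> 'a pmf \<Rightarrow> ('a \<times> 'a) pmf set" where
  "couplings \<mu> \<nu> = {\<tau>. map_pmf fst \<tau> = \<mu> \<and> map_pmf snd \<tau> = \<nu>}"

text \<open>For finitely supported distributions the expectation is a finite sum and the infimum is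
  attained.\<close>

definition wasserstein1 :: "('a \<Rightarrow> 'a \<Rightarrow> real) \<Rightarrow> 'a pmf \<Rightarrow> 'a pmf \<Rightarrow> real" where
  "wasserstein1 D \<mu> \<nu> =
     (INF \<tau>\<in>couplings \<mu> \<nu>. measure_pmf.expectation \<tau> (\<lambda>(x, y). D x y))"

text \<open>
  A hypercube is given by its depth \<open>k\<close> below the root and its lowest corner \<open>a\<close>; its side length
  is \<open>2 * \<Phi> / 2 ^ k\<close>. Hypercubes are half-open so that halving them gives a partition. The half-open
  root misses a point of \<open>[0, \<Phi>]\<^sup>d\<close> only if some \<open>\<sigma> i = 0\<close>, which has probability \<open>0\<close>.
\<close>

type_synonym hypercube = "nat \<times> point"

fun hypercube_set :: "nat \<Rightarrow> real \<Rightarrow> hypercube \<Rightarrow> point set" where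
  "hypercube_set d \<Phi> (k, a) = (\<Pi>\<^sub>E i\<in>{..<d}. {a i ..< a i + 2 * \<Phi> / 2 ^ k})"

fun nonempty_halves :: "nat \<Rightarrow> real \<Rightarrow> point set \<Rightarrow> hypercube \<Rightarrow> hypercube set" where
  "nonempty_halves d \<Phi> X (k, a) =
     {(Suc k, b) | b. b \<in> (\<Pi>\<^sub>E i\<in>{..<d}. {a i, a i + \<Phi> / 2 ^ k}) \<and>
                      X \<inter> hypercube_set d \<Phi> (Suc k, b) \<noteq> {}}"

inductive_set quadtree_nodes :: "nat \<Rightarrow> real \<Rightarrow> point set \<Rightarrow> point \<Rightarrow> hypercube set"
  for d \<Phi> X \<sigma> where
  root: "(0, \<lambda>i\<in>{..<d}. \<sigma> i - \<Phi>) \<in> quadtree_nodes d \<Phi> X \<sigma>"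
| halve: "\<lbrakk>v \<in> quadtree_nodes d \<Phi> X \<sigma>; card (X \<inter> hypercube_set d \<Phi> v) > 1;
           w \<in> nonempty_halves d \<Phi> X v\<rbrakk> \<Longrightarrow> w \<in> quadtree_nodes d \<Phi> X \<sigma>"

definition quadtree_edges ::
    "nat \<Rightarrow> real \<Rightarrow> point set \<Rightarrow> point \<Rightarrow> (hypercube \<times> hypercube) set" where
  "quadtree_edges d \<Phi> X \<sigma> =
     {(v, w). v \<in> quadtree_nodes d \<Phi> X \<sigma> \<and> card (X \<inter> hypercube_set d \<Phi> v) > 1 \<and>
              w \<in> nonempty_halves d \<Phi> X v}"

text \<open>The quadtree is undirected: each edge gives two opposite arcs.\<close>

definition quadtree ::
    "nat \<Rightarrow> real \<Rightarrow> point set \<Rightarrow> point \<Rightarrow> (hypercube, hypercube \<times> hypercube) pre_digraph" where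
  "quadtree d \<Phi> X \<sigma> =
     \<lparr> verts = quadtree_nodes d \<Phi> X \<sigma>,
       arcs = quadtree_edges d \<Phi> X \<sigma> \<union> (quadtree_edges d \<Phi> X \<sigma>)\<inverse>,
       tail = fst, head = snd \<rparr>"

text \<open>Levels are real numbers, so that \<open>\<Phi>\<close> need not be a power of two; a cube at level \<open>l\<close>
  always has side length \<open>2 powr l\<close>. An edge is weighted by the level of its lower endpoint.\<close>

definition level :: "real \<Rightarrow> hypercube \<Rightarrow> real" where
  "level \<Phi> v = log 2 \<Phi> + 1 - real (fst v)"

definition edge_weight :: "real \<Rightarrow> hypercube \<times> hypercube \<Rightarrow> real" where
  "edge_weight \<Phi> = (\<lambda>(v, w). 2 powr min (level \<Phi> v) (level \<Phi> w))"

definition leaf :: "nat \<Rightarrow> real \<Rightarrow> point set \<Rightarrow> point \<Rightarrow> point \<Rightarrow> hypercube" where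
  "leaf d \<Phi> X \<sigma> x =
     (THE v. v \<in> quadtree_nodes d \<Phi> X \<sigma> \<and> X \<inter> hypercube_set d \<Phi> v = {x})"

definition quadtree_metric :: "nat \<Rightarrow> real \<Rightarrow> point set \<Rightarrow> point \<Rightarrow> point \<Rightarrow> point \<Rightarrow> real" where
  "quadtree_metric d \<Phi> X \<sigma> x y =
     real_of_ereal (wf_digraph.\<mu> (quadtree d \<Phi> X \<sigma>) (edge_weight \<Phi>)
                      (leaf d \<Phi> X \<sigma> x) (leaf d \<Phi> X \<sigma> y))"

definition shift_distribution :: "nat \<Rightarrow> real \<Rightarrow> point measure" where
  "shift_distribution d \<Phi> = PiM {..<d} (\<lambda>_. uniform_measure lborel {0..\<Phi>})"

text \<open>A dataset of \<open>n\<close> distributions is \<open>\<mu> 0, \<dots>, \<mu> (n - 1)\<close>.\<close>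

definition approx_nearest ::
    "('a pmf \<Rightarrow> 'a pmf \<Rightarrow> real) \<Rightarrow> real \<Rightarrow> nat \<Rightarrow> (nat \<Rightarrow> 'a pmf) \<Rightarrow> 'a pmf \<Rightarrow> nat \<Rightarrow> bool" where
  "approx_nearest W c n \<mu> \<nu> i \<longleftrightarrow> W (\<mu> i) \<nu> \<le> c * Min ((\<lambda>j. W (\<mu> j) \<nu>) ` {..<n})"

definition nearest :: "('a pmf \<Rightarrow> 'a pmf \<Rightarrow> real) \<Rightarrow> nat \<Rightarrow> (nat \<Rightarrow> 'a pmf) \<Rightarrow> 'a pmf \<Rightarrow> nat set" where
  "nearest W n \<mu> \<nu> = {i. i < n \<and> (\<forall>j<n. W (\<mu> i) \<nu> \<le> W (\<mu> j) \<nu>)}"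

text \<open>\<open>tie\<close> selects which one of several nearest distributions is returned.\<close>

definition quadtree_returns ::
    "(nat set \<Rightarrow> nat) \<Rightarrow> nat \<Rightarrow> real \<Rightarrow> point set \<Rightarrow> nat \<Rightarrow> (nat \<Rightarrow> point pmf) \<Rightarrow> point pmf \<Rightarrow>
     point \<Rightarrow> nat" where
  "quadtree_returns tie d \<Phi> X n \<mu> \<nu> \<sigma> =
     tie (nearest (wasserstein1 (quadtree_metric d \<Phi> X \<sigma>)) n \<mu> \<nu>)"

definition quadtree_guarantee :: "(nat set \<Rightarrow> nat) \<Rightarrow> real \<Rightarrow> nat \<Rightarrow> real \<Rightarrow> bool" where
  "quadtree_guarantee tie p n c \<longleftrightarrow>
     (\<forall>d \<Phi> X \<mu> \<nu>.
        d \<ge> 1 \<longrightarrow> \<Phi> > 0 \<longrightarrow> ground_set p d \<Phi> X \<longrightarrow>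
        (\<forall>i<n. set_pmf (\<mu> i) \<subseteq> X) \<longrightarrow> set_pmf \<nu> \<subseteq> X \<longrightarrow>
        measure (shift_distribution d \<Phi>)
          {\<sigma> \<in> space (shift_distribution d \<Phi>).
             approx_nearest (wasserstein1 (lp_dist p d)) c n \<mu> \<nu>
               (quadtree_returns tie d \<Phi> X n \<mu> \<nu> \<sigma>)} > 1 / 2)"

end

theory Submission
  imports Defs
begin

text \<open>
  Already in dimension one no factor works for two distributions. The query is uniform on
  \<open>M = 2 ^ m\<close> points \<open>(M + 1) * j\<close>, and its true neighbour is obtained by moving each of them by \<open>1\<close>.
  For every shift, the grid of side \<open>2 ^ i\<close> separates exactly one in \<open>2 ^ i\<close> of these pairs, at a
  tree cost of at least \<open>2 ^ i\<close>. So each of the \<open>m\<close> scales contributes a constant, and the quadtree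
  distance is at least \<open>m / 2\<close>. The competitor moves just one point, by \<open>2 ^ r * M\<close>, which costs
  \<open>2 ^ r\<close>. With probability \<open>1 / 2\<close> that move stays inside a cube of side \<open>2 ^ (r + 1) * M\<close>, and then
  its quadtree distance is at most \<open>2 ^ (r + 2)\<close>, which is below \<open>m / 2\<close> for \<open>m = 2 ^ (r + 4)\<close>.
\<close>

section \<open>Quadtrees on a line\<close>

definition line_point :: "real \<Rightarrow> point" where
  "line_point r = (\<lambda>i\<in>{..<1}. r)"

lemma line_point_0 [simp]: "line_point r 0 = r"
  by (simp add: line_point_def)

lemma inj_line_point: "inj line_point"
  by (metis injI line_point_0)

lemma line_point_eq_iff [simp]: "line_point x = line_point y \<longleftrightarrow> x = y"
  using inj_line_point by (auto dest: injD)

lemma PiE_line: "(\<Pi>\<^sub>E i\<in>{..<1::nat}. B i) = line_point ` B 0"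
proof (intro equalityI subsetI)
  fix f assume "f \<in> (\<Pi>\<^sub>E i\<in>{..<1::nat}. B i)"
  then have "f 0 \<in> B 0" "f = line_point (f 0)"
    by (auto simp: line_point_def PiE_iff extensional_def fun_eq_iff)
  then show "f \<in> line_point ` B 0" by blast
next
  fix f assume "f \<in> line_point ` B 0"
  then show "f \<in> (\<Pi>\<^sub>E i\<in>{..<1::nat}. B i)"
    by (auto simp: line_point_def PiE_iff)
qed

lemma line_point_in_hypercube:
  "line_point x \<in> hypercube_set 1 \<Phi> (k, a) \<longleftrightarrow> a 0 \<le> x \<and> x < a 0 + 2 * \<Phi> / 2 ^ k"
  unfolding hypercube_set.simps PiE_line by (simp add: image_iff)

text \<open>In dimension one every exponent gives the absolute difference, so a single instance on
  the line serves all \<open>p\<close> at once.\<close>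

lemma lp_dist_line_point:
  assumes "p \<ge> 1"
  shows "lp_dist p 1 (line_point x) (line_point y) = \<bar>x - y\<bar>"
  using assms by (simp add: lp_dist_def powr_powr)

text \<open>Because \<open>\<Phi>\<close> itself is not allowed as a point, the half-open root cube contains all points for
  every shift in \<open>[0, \<Phi>]\<close>, the endpoints included.\<close>

locale line_quadtree =
  fixes \<Phi> :: real and A :: "real set" and \<sigma> :: point
  assumes finite_A: "finite A"
    and A_bounds: "A \<subseteq> {0..<\<Phi>}"
    and separated: "\<And>x y. x \<in> A \<Longrightarrow> y \<in> A \<Longrightarrow> x \<noteq> y \<Longrightarrow> \<bar>x - y\<bar> \<ge> 1"
    and Phi_pos: "\<Phi> > 0"
    and shift: "\<sigma> 0 \<in> {0..\<Phi>}"
begin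

declare One_nat_def [simp del]

abbreviation "X \<equiv> line_point ` A"
abbreviation "N \<equiv> quadtree_nodes 1 \<Phi> X \<sigma>"
abbreviation "T \<equiv> quadtree 1 \<Phi> X \<sigma>"
abbreviation "dT \<equiv> \<lambda>x y. quadtree_metric 1 \<Phi> X \<sigma> (line_point x) (line_point y)"

section \<open>Cubes as integer intervals of nested grids\<close>

definition origin :: real where "origin = \<sigma> 0 - \<Phi>"

definition side :: "nat \<Rightarrow> real" where "side k = 2 * \<Phi> / 2 ^ k"

text \<open>Integer coordinate in the grid of depth \<open>k\<close>. Because the grids are nested,
  the parent of a cube is given by \<open>div 2\<close>, and the tree turns into integer
  arithmetic.\<close>

definition cell_index :: "nat \<Rightarrow> real \<Rightarrow> int" where
  "cell_index k x = \<lfloor>(x - origin) / side k\<rfloor>"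

definition cell :: "nat \<Rightarrow> int \<Rightarrow> hypercube" where
  "cell k i = (k, line_point (origin + of_int i * side k))"

lemma side_pos: "side k > 0"
  using Phi_pos by (simp add: side_def)

lemma side_Suc: "side (Suc k) = side k / 2"
  by (simp add: side_def)

lemma side_mono: "j \<le> k \<Longrightarrow> side k \<le> side j"
  using Phi_pos by (simp add: side_def field_simps)

lemma cell_index_Suc_div: "cell_index (Suc k) x div 2 = cell_index k x"
proof -
  have "(x - origin) / side k = (x - origin) / side (Suc k) / real_of_int 2"
    using side_pos[of k] by (simp add: side_Suc field_simps)
  then show ?thesis
    unfolding cell_index_def by (metis floor_divide_real_eq_div zero_le_numeral)
qed

lemma cell_index_eq_mono:
  assumes "cell_index k x = cell_index k y" "j \<le> k"
  shows "cell_index j x = cell_index j y"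
  using assms(2,1) by (induction rule: inc_induct) (metis cell_index_Suc_div)+

lemma cell_index_corner: "cell_index k (origin + of_int i * side k) = i"
  using side_pos[of k] by (simp add: cell_index_def)

lemma cell_index_0:
  assumes "x \<in> A"
  shows "cell_index 0 x = 0"
proof -
  have "0 \<le> x" "x < \<Phi>" "0 \<le> \<sigma> 0" "\<sigma> 0 \<le> \<Phi>"
    using assms A_bounds shift by auto
  then show ?thesis
    using Phi_pos by (simp add: cell_index_def origin_def side_def floor_eq_iff)
qed

lemma in_cell_iff: "line_point x \<in> hypercube_set 1 \<Phi> (cell k i) \<longleftrightarrow> cell_index k x = i"
proof -
  have "line_point x \<in> hypercube_set 1 \<Phi> (cell k i) \<longleftrightarrow>
        origin + of_int i * side k \<le> x \<and> x < origin + of_int i * side k + side k"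
    unfolding cell_def line_point_in_hypercube by (simp add: side_def)
  also have "\<dots> \<longleftrightarrow> cell_index k x = i"
    unfolding cell_index_def floor_eq_iff using side_pos[of k] by (auto simp: field_simps)
  finally show ?thesis .
qed

lemma root_eq_cell: "(0, \<lambda>i\<in>{..<1}. \<sigma> i - \<Phi>) = cell 0 0"
  by (auto simp: cell_def origin_def line_point_def)

text \<open>The two halves of cube \<open>i\<close> have indices \<open>2 * i\<close> and
  \<open>2 * i + 1\<close>, which are exactly the solutions of \<open>j div 2 = i\<close>.\<close>

lemma nonempty_halves_cell:
  "nonempty_halves 1 \<Phi> X (cell k i) =
     {cell (Suc k) j |j. j div 2 = i \<and> (\<exists>x\<in>A. cell_index (Suc k) x = j)}"
proof -
  have halves: "(\<Pi>\<^sub>E i'\<in>{..<1::nat}. {a, a + s}) = {line_point a, line_point (a + s)}" for a s :: real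
    unfolding PiE_line by simp
  have side: "\<Phi> / 2 ^ k = side (Suc k)"
    by (simp add: side_def)
  have corner: "origin + of_int i * side k = origin + of_int (2 * i) * side (Suc k)"
    "origin + of_int i * side k + side (Suc k) = origin + of_int (2 * i + 1) * side (Suc k)"
    by (auto simp: side_Suc algebra_simps)
  have div2: "j div 2 = i \<longleftrightarrow> j = 2 * i \<or> j = 2 * i + 1" for j
    by auto
  have meets: "X \<inter> hypercube_set 1 \<Phi> (cell (Suc k) j) \<noteq> {} \<longleftrightarrow>
      (\<exists>x\<in>A. cell_index (Suc k) x = j)" for j
    using in_cell_iff by blast
  have "nonempty_halves 1 \<Phi> X (cell k i) =
      {(Suc k, b) | b. b \<in> {line_point (origin + of_int (2 * i) * side (Suc k)),
                            line_point (origin + of_int (2 * i + 1) * side (Suc k))} \<and>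
                      X \<inter> hypercube_set 1 \<Phi> (Suc k, b) \<noteq> {}}"
    unfolding cell_def nonempty_halves.simps side corner[symmetric]
    using PiE_line[of "\<lambda>i'. {line_point (origin + of_int i * side k) i',
       line_point (origin + of_int i * side k) i' + side (Suc k)}"]
    by simp
  also have "\<dots> = {cell (Suc k) j | j. (j = 2 * i \<or> j = 2 * i + 1) \<and>
                      X \<inter> hypercube_set 1 \<Phi> (cell (Suc k) j) \<noteq> {}}"
    unfolding cell_def by blast
  finally show ?thesis
    unfolding meets div2 .
qed

section \<open>Nodes, edges and weights of the tree\<close>

lemma node_is_cell: "v \<in> N \<Longrightarrow> \<exists>i. v = cell (fst v) i"
proof (induction rule: quadtree_nodes.induct)
  case root
  then show ?case by (metis root_eq_cell cell_def fst_conv)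
next
  case (halve v w)
  then obtain i where "v = cell (fst v) i" by blast
  with halve have "w \<in> nonempty_halves 1 \<Phi> X (cell (fst v) i)" by simp
  then show ?case unfolding nonempty_halves_cell by (auto simp: cell_def)
qed

text \<open>A half is kept only if it contains a point, and that one point determines the index at
  both ends of the edge.\<close>

lemma edge_cases:
  assumes "(v, w) \<in> quadtree_edges 1 \<Phi> X \<sigma>"
  obtains k x where "x \<in> A" "v = cell k (cell_index k x)" "w = cell (Suc k) (cell_index (Suc k) x)"
proof -
  from assms have v: "v \<in> N" and w: "w \<in> nonempty_halves 1 \<Phi> X v"
    by (auto simp: quadtree_edges_def)
  from node_is_cell[OF v] obtain i where i: "v = cell (fst v) i" by blast
  with w have "w \<in> nonempty_halves 1 \<Phi> X (cell (fst v) i)" by simp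
  then obtain x where "x \<in> A" "w = cell (Suc (fst v)) (cell_index (Suc (fst v)) x)"
      "cell_index (Suc (fst v)) x div 2 = i"
    unfolding nonempty_halves_cell by blast
  with i that show thesis
    by (metis cell_index_Suc_div)
qed

lemma points_in_cell: "X \<inter> hypercube_set 1 \<Phi> (cell k i) = line_point ` {x\<in>A. cell_index k x = i}"
  using in_cell_iff by blast

lemma card_in_cell: "card (X \<inter> hypercube_set 1 \<Phi> (cell k i)) = card {x\<in>A. cell_index k x = i}"
  unfolding points_in_cell by (simp add: card_image inj_on_subset[OF inj_line_point])

lemma edge_to_child:
  assumes "cell k (cell_index k x) \<in> N" "x \<in> A" "y \<in> A" "x \<noteq> y" "cell_index k x = cell_index k y"
  shows "(cell k (cell_index k x), cell (Suc k) (cell_index (Suc k) x)) \<in> quadtree_edges 1 \<Phi> X \<sigma>"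
proof -
  have "{x, y} \<subseteq> {z\<in>A. cell_index k z = cell_index k x}"
    using assms by auto
  then have "card {x, y} \<le> card {z\<in>A. cell_index k z = cell_index k x}"
    using finite_A by (intro card_mono) auto
  then have "card (X \<inter> hypercube_set 1 \<Phi> (cell k (cell_index k x))) > 1"
    unfolding card_in_cell using assms by simp
  moreover have "cell (Suc k) (cell_index (Suc k) x) \<in> nonempty_halves 1 \<Phi> X (cell k (cell_index k x))"
    unfolding nonempty_halves_cell using assms cell_index_Suc_div by blast
  ultimately show ?thesis
    using assms by (simp add: quadtree_edges_def)
qed

lemma edge_snd_in_nodes: "(v, w) \<in> quadtree_edges 1 \<Phi> X \<sigma> \<Longrightarrow> w \<in> N"
  by (auto simp: quadtree_edges_def intro: quadtree_nodes.halve)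

sublocale wf_digraph T
  by standard (auto simp: quadtree_def edge_snd_in_nodes, auto simp: quadtree_edges_def)

lemma verts_T [simp]: "verts T = N" and tail_T [simp]: "tail T = fst" and head_T [simp]: "head T = snd"
  by (simp_all add: quadtree_def)

lemma arcs_T: "arcs T = quadtree_edges 1 \<Phi> X \<sigma> \<union> (quadtree_edges 1 \<Phi> X \<sigma>)\<inverse>"
  by (simp add: quadtree_def)

text \<open>The lower end, at depth \<open>Suc k\<close>, has level \<open>log 2 \<Phi> - k\<close>,
  so the weight of an edge is the side of its smaller cube, in both orientations.\<close>

lemma weight_cell:
  "edge_weight \<Phi> (cell k i, cell (Suc k) j) = side (Suc k)"
  "edge_weight \<Phi> (cell (Suc k) j, cell k i) = side (Suc k)"
proof -
  have "2 powr (log 2 \<Phi> - real k) = \<Phi> / 2 ^ k"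
    using Phi_pos by (simp add: powr_diff powr_realpow)
  then show "edge_weight \<Phi> (cell k i, cell (Suc k) j) = side (Suc k)"
    "edge_weight \<Phi> (cell (Suc k) j, cell k i) = side (Suc k)"
    by (auto simp: edge_weight_def level_def cell_def side_def min_def)
qed

lemma weight_nonneg: "edge_weight \<Phi> e \<ge> 0"
  by (auto simp: edge_weight_def split: prod.splits)

lemma root_in_N: "x \<in> A \<Longrightarrow> cell 0 (cell_index 0 x) \<in> N"
  using quadtree_nodes.root[where d = 1 and \<sigma> = \<sigma> and \<Phi> = \<Phi> and X = X] by (simp only: root_eq_cell cell_index_0)

text \<open>Every coarser cube around \<open>x\<close> also contains \<open>y\<close>, hence is
  halved, so the descent from the root reaches depth \<open>k\<close>.\<close>

lemma common_cell_in_N: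
  assumes "x \<in> A" "y \<in> A" "x \<noteq> y" "cell_index k x = cell_index k y"
  shows "cell k (cell_index k x) \<in> N"
  using assms(4)
proof (induction k)
  case 0
  then show ?case using root_in_N assms(1) by blast
next
  case (Suc k)
  then have "cell_index k x = cell_index k y"
    by (metis cell_index_Suc_div)
  with Suc show ?case
    using edge_to_child edge_snd_in_nodes assms by blast
qed

text \<open>A cube other than the root exists only because its parent was halved, and halving
  requires a second point there. This excludes nodes deeper than the leaf.\<close>

lemma parent_shared:
  assumes "cell (Suc k) (cell_index (Suc k) x) \<in> N" "x \<in> A"
  obtains y where "y \<in> A" "y \<noteq> x" "cell_index k y = cell_index k x"
proof -
  from assms(1) obtain v where v: "(v, cell (Suc k) (cell_index (Suc k) x)) \<in> quadtree_edges 1 \<Phi> X \<sigma>"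
    by (cases rule: quadtree_nodes.cases) (auto simp: cell_def quadtree_edges_def)
  then obtain k' z where z: "z \<in> A" "v = cell k' (cell_index k' z)"
      "cell (Suc k) (cell_index (Suc k) x) = cell (Suc k') (cell_index (Suc k') z)"
    by (elim edge_cases)
  then have "k' = k"
    by (auto simp: cell_def)
  with z have "cell_index (Suc k) x = cell_index (Suc k) z"
    by (metis in_cell_iff)
  with z \<open>k' = k\<close> have "v = cell k (cell_index k x)"
    by (metis cell_index_Suc_div)
  with v have "card {y\<in>A. cell_index k y = cell_index k x} > 1"
    by (auto simp: quadtree_edges_def card_in_cell)
  then have "\<not> {y\<in>A. cell_index k y = cell_index k x} \<subseteq> {x}"
    by (metis card.empty card.insert card_mono empty_iff finite.emptyI finite.insertI not_less One_nat_def)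
  with that show thesis by blast
qed

section \<open>Leaves\<close>

lemma singleton_cell_exists:
  assumes "x \<in> A"
  shows "\<exists>k. \<forall>y\<in>A. cell_index k y = cell_index k x \<longrightarrow> y = x"
proof -
  obtain k where "2 * \<Phi> < 2 ^ k"
    using real_arch_pow[of 2 "2 * \<Phi>"] by auto
  then have k: "side k < 1"
    by (simp add: side_def)
  \<comment> \<open>Two points of one cell are closer than its side, which is now below the minimum
    distance \<open>1\<close>.\<close>
  have "y = x" if "y \<in> A" "cell_index k y = cell_index k x" for y
  proof (rule ccontr)
    assume "y \<noteq> x"
    define i where "i = cell_index k x"
    have "of_int i \<le> (z - origin) / side k \<and> (z - origin) / side k < of_int i + 1"
      if "z = x \<or> z = y" for z
      using that \<open>cell_index k y = cell_index k x\<close> unfolding i_def cell_index_def by auto linarith+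
    from this[of x] this[of y] have "\<bar>x - y\<bar> < side k"
      using side_pos[of k] by (simp add: field_simps abs_less_iff)
    with k separated[OF \<open>y \<in> A\<close> \<open>x \<in> A\<close> \<open>y \<noteq> x\<close>] show False by linarith
  qed
  then show ?thesis by blast
qed

text \<open>The leaf sits at the first depth where \<open>x\<close> is alone in its cell. Since
  \<open>leaf\<close> is a definite description, uniqueness must be shown: coarser cells contain
  other points, and deeper ones are not nodes.\<close>

lemma leaf_cell:
  assumes "x \<in> A"
  obtains k where "leaf 1 \<Phi> X \<sigma> (line_point x) = cell k (cell_index k x)"
    "cell k (cell_index k x) \<in> N"
    "\<And>y. y \<in> A \<Longrightarrow> cell_index k y = cell_index k x \<Longrightarrow> y = x"
    "\<And>j. j < k \<Longrightarrow> \<exists>y\<in>A. y \<noteq> x \<and> cell_index j x = cell_index j y"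
proof -
  define single where "single k \<longleftrightarrow> (\<forall>y\<in>A. cell_index k y = cell_index k x \<longrightarrow> y = x)" for k
  define k where "k = (LEAST k. single k)"
  have "\<exists>k. single k"
    unfolding single_def using singleton_cell_exists[OF assms] .
  then have single: "single k"
    unfolding k_def by (rule LeastI_ex)
  have shared: "\<exists>y\<in>A. y \<noteq> x \<and> cell_index j x = cell_index j y" if "j < k" for j
    using not_less_Least[OF that[unfolded k_def]] by (force simp: single_def)
  have node: "cell k (cell_index k x) \<in> N"
  proof (cases k)
    case 0
    then show ?thesis using root_in_N assms by simp
  next
    case (Suc j)
    with shared obtain y where "y \<in> A" "y \<noteq> x" "cell_index j x = cell_index j y"
      by blast
    then show ?thesis
      using Suc assms edge_to_child common_cell_in_N edge_snd_in_nodes by metis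
  qed
  have meets: "X \<inter> hypercube_set 1 \<Phi> (cell j i) = {line_point x} \<longleftrightarrow> cell_index j x = i \<and> single j" for j i
  proof -
    have "X \<inter> hypercube_set 1 \<Phi> (cell j i) = {line_point x} \<longleftrightarrow> {y\<in>A. cell_index j y = i} = {x}"
      unfolding points_in_cell using inj_image_eq_iff[OF inj_line_point, of _ "{x}"] by simp
    also have "\<dots> \<longleftrightarrow> cell_index j x = i \<and> single j"
      unfolding single_def set_eq_iff mem_Collect_eq singleton_iff using assms by metis
    finally show ?thesis .
  qed
  have unique: "v = cell k (cell_index k x)"
    if v: "v \<in> N" "X \<inter> hypercube_set 1 \<Phi> v = {line_point x}" for v
  proof -
    obtain i where i: "v = cell (fst v) i"
      using node_is_cell v by blast
    with v meets have j: "cell_index (fst v) x = i" "single (fst v)"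
      by metis+
    then have "k \<le> fst v"
      unfolding k_def by (simp add: Least_le)
    \<comment> \<open>A deeper node would have a parent at some depth \<open>j \<ge> k\<close> that
      still holds a second point, and this point would share the cell of \<open>x\<close> at depth
      \<open>k\<close> as well.\<close>
    moreover have "\<not> k < fst v"
    proof
      assume "k < fst v"
      then obtain j where "fst v = Suc j" "k \<le> j"
        by (metis less_eq_Suc_le Suc_le_D Suc_le_mono)
      with parent_shared[of j x] v i j assms obtain y where "y \<in> A" "y \<noteq> x" "cell_index j y = cell_index j x"
        by metis
      with single \<open>k \<le> j\<close> show False
        unfolding single_def using cell_index_eq_mono by blast
    qed
    ultimately show ?thesis
      using i j by simp
  qed
  have "X \<inter> hypercube_set 1 \<Phi> (cell k (cell_index k x)) = {line_point x}"
    using meets single by simp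
  with node unique have "leaf 1 \<Phi> X \<sigma> (line_point x) = cell k (cell_index k x)"
    unfolding leaf_def by (intro the_equality conjI) blast+
  with node single shared that show thesis
    unfolding single_def by blast
qed

section \<open>Walks and upper bounds on the tree metric\<close>

lemma walk_down:
  assumes "x \<in> A" "j \<le> k" "cell j (cell_index j x) \<in> N"
    and shared: "\<And>i. j \<le> i \<Longrightarrow> i < k \<Longrightarrow> \<exists>y\<in>A. y \<noteq> x \<and> cell_index i x = cell_index i y"
  shows "(\<exists>p. awalk (cell j (cell_index j x)) p (cell k (cell_index k x)) \<and>
              awalk_cost (edge_weight \<Phi>) p = side j - side k) \<and>
         (\<exists>p. awalk (cell k (cell_index k x)) p (cell j (cell_index j x)) \<and>
              awalk_cost (edge_weight \<Phi>) p = side j - side k)"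
  using assms(2) shared
proof (induction k rule: dec_induct)
  case base
  show ?case using assms by (auto intro!: exI[of _ "[]"] simp: awalk_Nil_iff)
next
  case (step k)
  then obtain p q where
    p: "awalk (cell j (cell_index j x)) p (cell k (cell_index k x))" 
       "awalk_cost (edge_weight \<Phi>) p = side j - side k" and
    q: "awalk (cell k (cell_index k x)) q (cell j (cell_index j x))" 
       "awalk_cost (edge_weight \<Phi>) q = side j - side k"
    by (metis less_SucI)
  from step obtain y where "y \<in> A" "y \<noteq> x" "cell_index k x = cell_index k y"
    by blast
  then have e: "(cell k (cell_index k x), cell (Suc k) (cell_index (Suc k) x)) \<in> quadtree_edges 1 \<Phi> X \<sigma>"
    using assms edge_to_child common_cell_in_N by metis
  let ?e = "(cell k (cell_index k x), cell (Suc k) (cell_index (Suc k) x))"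
  let ?e' = "(cell (Suc k) (cell_index (Suc k) x), cell k (cell_index k x))"
  have "?e \<in> arcs T" "?e' \<in> arcs T"
    using e by (auto simp: arcs_T)
  then have "awalk (cell k (cell_index k x)) [?e] (cell (Suc k) (cell_index (Suc k) x))"
    "awalk (cell (Suc k) (cell_index (Suc k) x)) [?e'] (cell k (cell_index k x))"
    using arc_implies_awalk[of ?e] arc_implies_awalk[of ?e'] unfolding tail_T head_T fst_conv snd_conv
    by blast+
  with p q have "awalk (cell j (cell_index j x)) (p @ [?e]) (cell (Suc k) (cell_index (Suc k) x))"
    "awalk (cell (Suc k) (cell_index (Suc k) x)) ([?e'] @ q) (cell j (cell_index j x))"
    using awalk_appendI by blast+
  \<comment> \<open>The new edge costs \<open>side (Suc k) = side k - side (Suc k)\<close>, so the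
    total telescopes. Descent and ascent are treated together because arcs are oriented.\<close>
  moreover have "awalk_cost (edge_weight \<Phi>) (p @ [?e]) = side j - side (Suc k)"
    "awalk_cost (edge_weight \<Phi>) ([?e'] @ q) = side j - side (Suc k)"
    using p q by (simp_all add: weight_cell side_Suc)
  ultimately show ?case by blast
qed

lemma awalk_cost_nonneg: "awalk_cost (edge_weight \<Phi>) p \<ge> 0"
  by (induction p) (auto simp: weight_nonneg)

lemma mu_nonneg: "\<mu> (edge_weight \<Phi>) u v \<ge> 0"
  unfolding \<mu>_def by (auto intro!: INF_greatest simp: awalk_cost_nonneg)

lemma dT_nonneg: "quadtree_metric 1 \<Phi> X \<sigma> x y \<ge> 0"
  unfolding quadtree_metric_def by (simp add: mu_nonneg real_of_ereal_pos)

text \<open>Climb from one leaf to the common cube and descend to the other; each leg costs less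
  than \<open>side j\<close>.\<close>

lemma walk_between_leaves:
  assumes "x \<in> A" "y \<in> A" "x \<noteq> y" "cell_index j x = cell_index j y"
  obtains p where "awalk (leaf 1 \<Phi> X \<sigma> (line_point x)) p (leaf 1 \<Phi> X \<sigma> (line_point y))"
    "awalk_cost (edge_weight \<Phi>) p \<le> 2 * side j"
proof -
  have to_leaf: "\<exists>k. leaf 1 \<Phi> X \<sigma> (line_point u) = cell k (cell_index k u) \<and>
        (\<exists>p. awalk (cell j (cell_index j u)) p (cell k (cell_index k u)) \<and>
              awalk_cost (edge_weight \<Phi>) p = side j - side k) \<and>
         (\<exists>p. awalk (cell k (cell_index k u)) p (cell j (cell_index j u)) \<and>
              awalk_cost (edge_weight \<Phi>) p = side j - side k)"
    if "u \<in> A" "w \<in> A" "u \<noteq> w" "cell_index j u = cell_index j w" for u w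
  proof -
    from leaf_cell[OF \<open>u \<in> A\<close>] obtain k where k:
      "leaf 1 \<Phi> X \<sigma> (line_point u) = cell k (cell_index k u)"
      "\<And>y. y \<in> A \<Longrightarrow> cell_index k y = cell_index k u \<Longrightarrow> y = u"
      "\<And>j. j < k \<Longrightarrow> \<exists>y\<in>A. y \<noteq> u \<and> cell_index j u = cell_index j y"
      by metis
    \<comment> \<open>A leaf above depth \<open>j\<close> would still contain the companion
      \<open>w\<close>.\<close>
    have "j \<le> k"
      using k(2)[of w] that cell_index_eq_mono[of j u w k] by force
    with walk_down[OF \<open>u \<in> A\<close> this common_cell_in_N[OF that]] k show ?thesis by blast
  qed
  from to_leaf[OF assms] to_leaf[OF assms(2,1)] assms(3,4)
  obtain k l p q where
    "leaf 1 \<Phi> X \<sigma> (line_point x) = cell k (cell_index k x)"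
    "awalk (cell k (cell_index k x)) p (cell j (cell_index j x))"
    "awalk_cost (edge_weight \<Phi>) p = side j - side k"
    "leaf 1 \<Phi> X \<sigma> (line_point y) = cell l (cell_index l y)"
    "awalk (cell j (cell_index j x)) q (cell l (cell_index l y))"
    "awalk_cost (edge_weight \<Phi>) q = side j - side l"
    by metis
  then show thesis
    using that[of "p @ q"] side_pos[of k] side_pos[of l] by (simp add: awalk_appendI)
qed

lemma dT_le_walk_cost:
  assumes "awalk (leaf 1 \<Phi> X \<sigma> (line_point x)) p (leaf 1 \<Phi> X \<sigma> (line_point y))"
  shows "dT x y \<le> awalk_cost (edge_weight \<Phi>) p"
proof -
  let ?m = "\<mu> (edge_weight \<Phi>) (leaf 1 \<Phi> X \<sigma> (line_point x)) (leaf 1 \<Phi> X \<sigma> (line_point y))"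
  have "?m \<le> ereal (awalk_cost (edge_weight \<Phi>) p)" "?m \<ge> 0"
    using min_cost_le_walk_cost[OF assms] mu_nonneg by auto
  \<comment> \<open>The two bounds make \<open>?m\<close> finite, so \<open>real_of_ereal\<close>
    does not fall back to its default \<open>0\<close>.\<close>
  then show ?thesis
    unfolding quadtree_metric_def by (cases ?m) auto
qed

lemma dT_refl:
  assumes "x \<in> A"
  shows "dT x x = 0"
proof (rule antisym)
  have "leaf 1 \<Phi> X \<sigma> (line_point x) \<in> N"
    using leaf_cell[OF assms] by metis
  then show "dT x x \<le> 0"
    using dT_le_walk_cost[of x "[]" x] by (simp add: awalk_Nil_iff)
qed (rule dT_nonneg)

lemma dT_le:
  assumes "x \<in> A" "y \<in> A" "cell_index j x = cell_index j y"
  shows "dT x y \<le> 2 * side j"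
proof (cases "x = y")
  case True
  then show ?thesis
    using dT_refl assms side_pos[of j] by simp
next
  case False
  then obtain p where "awalk (leaf 1 \<Phi> X \<sigma> (line_point x)) p (leaf 1 \<Phi> X \<sigma> (line_point y))"
    "awalk_cost (edge_weight \<Phi>) p \<le> 2 * side j"
    using walk_between_leaves[OF assms(1,2) _ assms(3)] by blast
  with dT_le_walk_cost show ?thesis
    by force
qed

text \<open>An indicator of the subtree below a cube changes only across the edge above that cube, so it
  bounds from below the cost of any walk that enters the subtree.\<close>

definition below :: "nat \<Rightarrow> int \<Rightarrow> hypercube \<Rightarrow> real" where
  "below k i v = (if k \<le> fst v \<and> cell_index k (snd v 0) = i then 1 else 0)"

lemma below_cell:
  "below k i (cell j (cell_index j x)) = (if k \<le> j \<and> cell_index k x = i then 1 else 0)"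
proof -
  have "k \<le> j \<longrightarrow> cell_index k (origin + of_int (cell_index j x) * side j) = cell_index k x"
    using cell_index_eq_mono[OF cell_index_corner] by blast
  then show ?thesis by (auto simp: below_def cell_def)
qed

lemma below_edge:
  assumes "e \<in> arcs T"
  shows "side k * (below k i (snd e) - below k i (fst e)) \<le> edge_weight \<Phi> e"
proof -
  \<comment> \<open>The indicator jumps only if the lower end has depth \<open>k\<close>, and that
    edge weighs \<open>side k\<close>. The absolute value and the symmetric weight cover both arcs
    of the edge.\<close>
  have *: "side k * \<bar>below k i w - below k i v\<bar> \<le> edge_weight \<Phi> (v, w) \<and> edge_weight \<Phi> (w, v) = edge_weight \<Phi> (v, w)"
    if vw: "(v, w) \<in> quadtree_edges 1 \<Phi> X \<sigma>" for v w
  proof -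
    obtain j x where x: "v = cell j (cell_index j x)" "w = cell (Suc j) (cell_index (Suc j) x)"
      using edge_cases[OF vw] by metis
    then show ?thesis
      using side_pos[of k] side_pos[of "Suc j"] side_mono[of "Suc j" k]
      by (auto simp: weight_cell below_cell le_Suc_eq)
  qed
  have le: "side k * t \<le> side k * \<bar>t\<bar>" for t
    using side_pos[of k] by (simp add: mult_left_mono)
  obtain v w where e: "e = (v, w)" by (cases e)
  with assms consider "(v, w) \<in> quadtree_edges 1 \<Phi> X \<sigma>" | "(w, v) \<in> quadtree_edges 1 \<Phi> X \<sigma>"
    by (auto simp: arcs_T)
  then show ?thesis
  proof cases
    case 1
    from *[OF this] le[of "below k i w - below k i v"] show ?thesis
      by (simp add: e)
  next
    case 2
    from *[OF this] le[of "below k i w - below k i v"] show ?thesis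
      by (simp add: e abs_minus_commute)
  qed
qed

lemma below_awalk:
  assumes "awalk u p v"
  shows "side k * (below k i v - below k i u) \<le> awalk_cost (edge_weight \<Phi>) p"
  using assms
proof (induction p arbitrary: u)
  case Nil
  then show ?case by (simp add: awalk_Nil_iff)
next
  case (Cons e p)
  then have "e \<in> arcs T" "fst e = u" "awalk (snd e) p v"
    by (auto simp: awalk_Cons_iff)
  with Cons.IH[of "snd e"] below_edge[of e k i] show ?case
    by (simp add: right_diff_distrib)
qed

text \<open>The leaf of \<open>y\<close> may lie above depth \<open>k\<close>, so the indicator is
  used at the first separating depth \<open>l\<close> instead. The leaf does reach depth
  \<open>l\<close>, since any coarser cube of \<open>y\<close> also contains \<open>x\<close>; and
  \<open>side l\<close> is at least \<open>side k\<close>.\<close>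

lemma dT_ge:
  assumes "x \<in> A" "y \<in> A" "cell_index k x \<noteq> cell_index k y"
  shows "dT x y \<ge> side k"
proof -
  define l where "l = (LEAST l. cell_index l x \<noteq> cell_index l y)"
  have l: "cell_index l x \<noteq> cell_index l y"
    unfolding l_def using assms(3) by (rule LeastI)
  have "l \<le> k"
    unfolding l_def using assms(3) by (rule Least_le)
  have same: "cell_index j x = cell_index j y" if "j < l" for j
    using not_less_Least[OF that[unfolded l_def]] by simp
  have "x \<noteq> y" using assms(3) by auto
  obtain k1 where k1: "leaf 1 \<Phi> X \<sigma> (line_point x) = cell k1 (cell_index k1 x)"
    using leaf_cell[OF assms(1)] by metis
  obtain k2 where k2: "leaf 1 \<Phi> X \<sigma> (line_point y) = cell k2 (cell_index k2 y)"
      "\<And>z. z \<in> A \<Longrightarrow> cell_index k2 z = cell_index k2 y \<Longrightarrow> z = y"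
    using leaf_cell[OF assms(2)] by metis
  have "l \<le> k2"
    using k2(2)[OF assms(1) same] \<open>x \<noteq> y\<close> by fastforce
  then have "side l \<le> awalk_cost (edge_weight \<Phi>) p"
    if "awalk (leaf 1 \<Phi> X \<sigma> (line_point x)) p (leaf 1 \<Phi> X \<sigma> (line_point y))" for p
    using below_awalk[OF that, of l "cell_index l y"] l by (simp add: k1 k2 below_cell)
  then have ge: "ereal (side l) \<le> \<mu> (edge_weight \<Phi>) (leaf 1 \<Phi> X \<sigma> (line_point x)) (leaf 1 \<Phi> X \<sigma> (line_point y))"
    unfolding \<mu>_def by (auto intro!: INF_greatest)
  \<comment> \<open>The existence of a walk, through the common root, makes the minimum cost finite;
    for an infinite one \<open>real_of_ereal\<close> would give \<open>0\<close>.\<close>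
  obtain p where "awalk (leaf 1 \<Phi> X \<sigma> (line_point x)) p (leaf 1 \<Phi> X \<sigma> (line_point y))"
    using walk_between_leaves[of x y 0] assms \<open>x \<noteq> y\<close> cell_index_0 by metis
  then have "\<mu> (edge_weight \<Phi>) (leaf 1 \<Phi> X \<sigma> (line_point x)) (leaf 1 \<Phi> X \<sigma> (line_point y)) \<le> ereal (awalk_cost (edge_weight \<Phi>) p)"
    using min_cost_le_walk_cost by simp
  with ge have "side l \<le> dT x y"
    unfolding quadtree_metric_def by (cases "\<mu> (edge_weight \<Phi>) (leaf 1 \<Phi> X \<sigma> (line_point x)) (leaf 1 \<Phi> X \<sigma> (line_point y))") auto
  then show ?thesis
    using side_mono[OF \<open>l \<le> k\<close>] by simp
qed

end

section \<open>Bounds on the Wasserstein distance\<close>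

lemma couplings_nonempty: "couplings \<mu> \<nu> \<noteq> {}"
proof -
  have "pair_pmf \<mu> \<nu> \<in> couplings \<mu> \<nu>"
    by (simp add: couplings_def map_fst_pair_pmf map_snd_pair_pmf)
  then show ?thesis by blast
qed

lemma finite_set_coupling:
  assumes "\<tau> \<in> couplings \<mu> \<nu>" "finite (set_pmf \<mu>)" "finite (set_pmf \<nu>)"
  shows "set_pmf \<tau> \<subseteq> set_pmf \<mu> \<times> set_pmf \<nu>" "finite (set_pmf \<tau>)"
proof -
  have "set_pmf \<mu> = fst ` set_pmf \<tau>" "set_pmf \<nu> = snd ` set_pmf \<tau>"
    using assms(1) unfolding couplings_def set_map_pmf[symmetric] by simp_all
  then show "set_pmf \<tau> \<subseteq> set_pmf \<mu> \<times> set_pmf \<nu>"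
    by force
  then show "finite (set_pmf \<tau>)"
    using assms(2,3) by (meson finite_SigmaI finite_subset)
qed

text \<open>One common draw \<open>j\<close> from \<open>U\<close> couples \<open>f j\<close> with
  \<open>g j\<close>.\<close>

lemma wasserstein1_map_le:
  assumes "\<And>x y. D x y \<ge> 0"
  shows "wasserstein1 D (map_pmf f U) (map_pmf g U) \<le> measure_pmf.expectation U (\<lambda>j. D (f j) (g j))"
proof -
  define \<tau> where "\<tau> = map_pmf (\<lambda>j. (f j, g j)) U"
  have "\<tau> \<in> couplings (map_pmf f U) (map_pmf g U)"
    by (simp add: couplings_def \<tau>_def pmf.map_comp o_def)
  moreover have "bdd_below ((\<lambda>\<tau>. measure_pmf.expectation \<tau> (\<lambda>(x, y). D x y)) ` couplings (map_pmf f U) (map_pmf g U))"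
    by (rule bdd_belowI[of _ 0]) (auto intro!: integral_nonneg_AE simp: assms split: prod.splits)
  ultimately have "wasserstein1 D (map_pmf f U) (map_pmf g U) \<le> measure_pmf.expectation \<tau> (\<lambda>(x, y). D x y)"
    unfolding wasserstein1_def by (rule cINF_lower[rotated])
  then show ?thesis
    by (simp add: \<tau>_def)
qed

text \<open>Weak Kantorovich duality: under any coupling the expectation of
  \<open>\<phi> + \<psi>\<close> depends on the marginals alone. Finite supports settle
  integrability.\<close>

lemma wasserstein1_ge_dual:
  assumes fin: "finite (set_pmf \<mu>)" "finite (set_pmf \<nu>)"
    and dual: "\<And>x y. x \<in> set_pmf \<mu> \<Longrightarrow> y \<in> set_pmf \<nu> \<Longrightarrow> \<phi> x + \<psi> y \<le> D x y"
  shows "measure_pmf.expectation \<mu> \<phi> + measure_pmf.expectation \<nu> \<psi> \<le> wasserstein1 D \<mu> \<nu>"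
  unfolding wasserstein1_def
proof (rule cINF_greatest[OF couplings_nonempty])
  fix \<tau> assume \<tau>: "\<tau> \<in> couplings \<mu> \<nu>"
  note \<tau>' = finite_set_coupling[OF \<tau> fin]
  have int: "integrable (measure_pmf \<tau>) h" for h :: "_ \<Rightarrow> real"
    using \<tau>'(2) by (rule integrable_measure_pmf_finite)
  have "measure_pmf.expectation \<mu> \<phi> + measure_pmf.expectation \<nu> \<psi> =
      measure_pmf.expectation (map_pmf fst \<tau>) \<phi> + measure_pmf.expectation (map_pmf snd \<tau>) \<psi>"
    using \<tau> by (simp add: couplings_def)
  also have "\<dots> = measure_pmf.expectation \<tau> (\<lambda>z. \<phi> (fst z) + \<psi> (snd z))"
    by (simp add: int)
  also have "\<dots> \<le> measure_pmf.expectation \<tau> (\<lambda>(x, y). D x y)"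
    using \<tau>'(1) by (intro integral_mono_AE int) (auto simp: AE_measure_pmf_iff intro!: dual)
  finally show "measure_pmf.expectation \<mu> \<phi> + measure_pmf.expectation \<nu> \<psi> \<le> measure_pmf.expectation \<tau> (\<lambda>(x, y). D x y)" .
qed

lemma wasserstein1_nonneg:
  assumes "\<And>x y. D x y \<ge> 0"
  shows "wasserstein1 D \<mu> \<nu> \<ge> 0"
  unfolding wasserstein1_def
by (rule cINF_greatest[OF couplings_nonempty])
    (auto intro!: integral_nonneg_AE simp: assms split: prod.splits)

section \<open>The hard instance\<close>

text \<open>Above the largest \<open>i\<close> with \<open>\<delta> i > 0\<close> the terms are not
  positive, and those up to \<open>i\<close> sum to less than \<open>2 ^ (i + 1)\<close>, hence to
  at most \<open>2 * d\<close>. This makes the potential for the near distribution feasible.\<close>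

lemma sum_dyadic_le:
  fixes \<delta> :: "nat \<Rightarrow> int" and d :: real
  assumes "\<And>i. i < m \<Longrightarrow> \<delta> i \<le> 1" "\<And>i. i < m \<Longrightarrow> \<delta> i > 0 \<Longrightarrow> 2 ^ i \<le> d" "d \<ge> 0"
  shows "(\<Sum>i<m. 2 ^ i * of_int (\<delta> i)) \<le> 2 * d"
  using assms(1,2)
proof (induction m)
  case 0
  then show ?case using assms(3) by simp
next
  case (Suc m)
  show ?case
  proof (cases "\<delta> m > 0")
    case True
    have "(\<Sum>i<Suc m. 2 ^ i * real_of_int (\<delta> i)) \<le> (\<Sum>i<Suc m. 2 ^ i * 1)"
      using Suc.prems(1) by (intro sum_mono mult_left_mono) auto
    also have "\<dots> \<le> 2 * 2 ^ m"
      by (simp add: sum_gp_strict[of "2::real", simplified])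
    also have "\<dots> \<le> 2 * d"
      using Suc.prems(2)[of m] True by simp
    finally show ?thesis .
  next
    case False
    then have "2 ^ m * real_of_int (\<delta> m) \<le> 0"
      by (simp add: mult_nonneg_nonpos)
    with Suc show ?thesis by fastforce
  qed
qed

text \<open>Since the spacing of the points \<open>(2 ^ m + 1) * j\<close> is \<open>1\<close> modulo every power of two up to
  \<open>2 ^ m\<close>, they run evenly through all residues, and the floors telescope.\<close>

lemma sum_floor_diff:
  fixes a :: real
  assumes "i \<le> m"
  shows "(\<Sum>j<2 ^ m. \<lfloor>(real ((2 ^ m + 1) * j) + 1 - a) / 2 ^ i\<rfloor> - \<lfloor>(real ((2 ^ m + 1) * j) - a) / 2 ^ i\<rfloor>) = 2 ^ (m - i)"
proof -
  define f where "f j = \<lfloor>(real j - a) / 2 ^ i\<rfloor>" for j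
  have pow: "(2::real) ^ m = 2 ^ i * 2 ^ (m - i)"
    using assms by (simp flip: power_add)
  \<comment> \<open>An integer multiple of \<open>2 ^ m\<close> is a multiple of
    \<open>2 ^ i\<close> and leaves the floor as an integer.\<close>
  have shift: "\<lfloor>(real n + r * 2 ^ m - a) / 2 ^ i\<rfloor> = f n + \<lfloor>r\<rfloor> * 2 ^ (m - i)" if "r \<in> \<int>" for n r
  proof -
    from that obtain k where k: "r = of_int k" by (auto elim: Ints_cases)
    have "(real n + r * 2 ^ m - a) / 2 ^ i = (real n - a) / 2 ^ i + of_int (k * 2 ^ (m - i))"
      unfolding pow k by (simp add: field_simps)
    then show ?thesis
      unfolding f_def k by (metis floor_add_int floor_of_int)
  qed
  \<comment> \<open>As \<open>(2 ^ m + 1) * j = j + j * 2 ^ m\<close>, both floors carry the same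
    offset \<open>j * 2 ^ (m - i)\<close>, which cancels.\<close>
  have "\<lfloor>(real ((2 ^ m + 1) * j) + 1 - a) / 2 ^ i\<rfloor> - \<lfloor>(real ((2 ^ m + 1) * j) - a) / 2 ^ i\<rfloor> = f (Suc j) - f j" for j
    using shift[of "real j" "Suc j"] shift[of "real j" j] by (simp add: algebra_simps)
  then have "(\<Sum>j<2 ^ m. \<lfloor>(real ((2 ^ m + 1) * j) + 1 - a) / 2 ^ i\<rfloor> - \<lfloor>(real ((2 ^ m + 1) * j) - a) / 2 ^ i\<rfloor>) = f (2 ^ m) - f 0"
    by (simp add: sum_lessThan_telescope)
  also have "\<dots> = 2 ^ (m - i)"
    using shift[of 1 0] by (simp add: f_def)
  finally show ?thesis .
qed

section \<open>Probabilities for the random shift\<close>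

lemma measure_shift_distribution_1:
  assumes "\<Phi> > 0" "B \<in> sets borel" "B \<subseteq> {0..\<Phi>}"
  shows "measure (shift_distribution 1 \<Phi>) {\<sigma> \<in> space (shift_distribution 1 \<Phi>). \<sigma> 0 \<in> B} = measure lborel B / \<Phi>"
    and "{\<sigma> \<in> space (shift_distribution 1 \<Phi>). \<sigma> 0 \<in> B} \<in> sets (shift_distribution 1 \<Phi>)"
    and "prob_space (shift_distribution 1 \<Phi>)"
proof -
  let ?u = "uniform_measure lborel {0..\<Phi>}" and ?S = "shift_distribution 1 \<Phi>"
  have u: "prob_space ?u"
    using assms(1) by (intro prob_space_uniform_measure) auto
  have meas: "(\<lambda>\<sigma>. \<sigma> 0) \<in> measurable ?S ?u"
    unfolding shift_distribution_def by (rule measurable_component_singleton) auto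
  have eq: "{\<sigma> \<in> space ?S. \<sigma> 0 \<in> B} = (\<lambda>\<sigma>. \<sigma> 0) -` B \<inter> space ?S"
    by auto
  show "{\<sigma> \<in> space ?S. \<sigma> 0 \<in> B} \<in> sets ?S"
    unfolding eq using assms(2) by (intro measurable_sets[OF meas]) simp
  show "prob_space ?S"
    unfolding shift_distribution_def by (intro prob_space_PiM u)
  have "measure ?S {\<sigma> \<in> space ?S. \<sigma> 0 \<in> B} = measure (distr ?S ?u (\<lambda>\<sigma>. \<sigma> 0)) B"
    unfolding eq using assms(2) by (intro measure_distr[OF meas, symmetric]) simp
  also have "distr ?S ?u (\<lambda>\<sigma>. \<sigma> 0) = ?u"
    unfolding shift_distribution_def using u by (intro distr_PiM_component) auto
  also have "measure ?u B = measure lborel ({0..\<Phi>} \<inter> B) / measure lborel {0..\<Phi>}"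
    using assms by (intro measure_uniform_measure) auto
  also have "\<dots> = measure lborel B / \<Phi>"
    using assms by (simp add: Int_absorb1)
  finally show "measure ?S {\<sigma> \<in> space ?S. \<sigma> 0 \<in> B} = measure lborel B / \<Phi>" .
qed

text \<open>With \<open>L = 2 * t\<close> these will be shifts for which \<open>0\<close> and
  \<open>t\<close> share a cell of side \<open>L\<close>. They fill half of each of the
  \<open>K\<close> periods.\<close>

lemma measure_upper_halves:
  fixes L :: real and K :: nat
  assumes "L > 0"
  defines "B \<equiv> \<Union>i<K. {of_nat i * L + L / 2 <.. of_nat i * L + L}"
  shows "B \<in> sets borel" "B \<subseteq> {0..of_nat K * L}" "measure lborel B = of_nat K * L / 2"
proof -
  let ?I = "\<lambda>i::nat. {of_nat i * L + L / 2 <.. of_nat i * L + L}"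
  show "B \<in> sets borel"
    unfolding B_def by auto
  have bound: "of_nat i * L + L \<le> of_nat j * L" if "i < j" for i j :: nat
  proof -
    have "(of_nat i + 1) * L \<le> of_nat j * L"
      using that assms by (intro mult_right_mono) auto
    then show ?thesis by (simp add: algebra_simps)
  qed
  show "B \<subseteq> {0..of_nat K * L}"
  proof
    fix s assume "s \<in> B"
    then obtain i where "i < K" "s \<in> ?I i"
      by (auto simp: B_def)
    moreover have "0 \<le> of_nat i * L"
      using assms by simp
    ultimately show "s \<in> {0..of_nat K * L}"
      using bound[of i K] assms(1)
      unfolding atLeastAtMost_iff greaterThanAtMost_iff by linarith
  qed
  have "disjoint_family_on ?I {..<K}"
  proof (unfold disjoint_family_on_def, intro ballI impI)
    fix i j :: nat assume "i \<noteq> j"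
    then consider "i < j" | "j < i" by linarith
    then show "?I i \<inter> ?I j = {}"
      by cases (use bound[of i j] bound[of j i] assms in fastforce)+
  qed
  then have "measure lborel B = (\<Sum>i<K. measure lborel (?I i))"
    unfolding B_def using assms(1) by (intro measure_finite_Union) (auto simp: emeasure_lborel_Ioc)
  also have "\<dots> = of_nat K * L / 2"
    using assms by simp
  finally show "measure lborel B = of_nat K * L / 2" .
qed

section \<open>Parameters and points of the instance that defeats factors below
  \<open>2 ^ r\<close>\<close>

locale hard_instance =
  fixes r :: nat
begin

declare One_nat_def [simp del]

definition m :: nat where "m = 2 ^ (r + 4)"
definition M :: nat where "M = 2 ^ m"
definition x :: "nat \<Rightarrow> real" where "x j = real ((2 ^ m + 1) * j)"
definition t :: real where "t = 2 ^ (m + r)"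
text \<open>A power of two, so that all cube sides are powers of two. It exceeds all points, since
  \<open>x j + 1 \<le> 2 ^ (2 * m)\<close> for \<open>j < M\<close>, and it is a multiple of
  \<open>2 * t\<close>.\<close>

definition \<Phi> :: real where "\<Phi> = 2 ^ (2 * m + 1)"
definition A :: "real set" where "A = x ` {..<M} \<union> (\<lambda>j. x j + 1) ` {..<M} \<union> {t}"
definition U :: "nat pmf" where "U = pmf_of_set {..<M}"
definition query :: "point pmf" where "query = map_pmf (\<lambda>j. line_point (x j)) U"
definition near :: "point pmf" where "near = map_pmf (\<lambda>j. line_point (x j + 1)) U"
definition moved :: "nat \<Rightarrow> real" where "moved j = (if j = 0 then t else x j)"
definition far :: "point pmf" where "far = map_pmf (\<lambda>j. line_point (moved j)) U"

lemma r_less_m: "r < m"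
proof -
  have "r < 2 ^ r" by (rule less_exp)
  also have "(2::nat) ^ r \<le> m"
    unfolding m_def by (intro power_increasing) auto
  finally show ?thesis .
qed

lemma M_pos: "M > 0"
  by (simp add: M_def)

lemma real_M: "real M = 2 ^ m"
  by (simp add: M_def)

lemma x_eq: "x j = (2 ^ m + 1) * real j"
  by (simp add: x_def)

lemma x_mono: "i \<le> j \<Longrightarrow> x i \<le> x j"
  unfolding x_eq by (intro mult_left_mono) auto

lemma x_0 [simp]: "x 0 = 0"
  by (simp add: x_def)

lemma Phi_pos: "\<Phi> > 0"
  by (simp add: \<Phi>_def)

lemma x_nonneg: "x j \<ge> 0"
  by (simp add: x_def)

lemma x_less: "j < M \<Longrightarrow> x j + 1 < \<Phi>"
proof -
  assume "j < M"
  then have "real j \<le> 2 ^ m - 1"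
    using real_M by linarith
  then have "x j \<le> (2 ^ m + 1) * (2 ^ m - 1)"
    unfolding x_eq by (intro mult_left_mono) auto
  also have "\<dots> = (2 ^ m) ^ 2 - 1"
    by (simp add: algebra_simps power2_eq_square)
  also have "(2 ^ m)\<^sup>2 = (2::real) ^ (2 * m)"
    by (simp add: power_mult [symmetric] mult.commute)
  finally have "x j + 1 \<le> 2 ^ (2 * m)"
    by simp
  also have "\<dots> < \<Phi>"
    by (simp add: \<Phi>_def)
  finally show ?thesis .
qed

lemma t_bounds: "0 < t" "t < \<Phi>"
proof -
  show "0 < t" by (simp add: t_def)
  show "t < \<Phi>"
    unfolding t_def \<Phi>_def using r_less_m by (intro power_strict_increasing) auto
qed

text \<open>Integrality gives the separation by at least \<open>1\<close>; the points
  \<open>0\<close> and \<open>1\<close> attain it.\<close>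

lemma A_Nats: "A \<subseteq> \<nat>"
proof -
  have "x j \<in> \<nat>" for j
    unfolding x_def by (rule of_nat_in_Nats)
  moreover have "t \<in> \<nat>"
    using of_nat_in_Nats[of "2 ^ (m + r)", where ?'a = real] by (simp add: t_def)
  ultimately show ?thesis
    by (auto simp: A_def)
qed

lemma A_bounds: "A \<subseteq> {0..<\<Phi>}"
  using x_less x_nonneg t_bounds by (fastforce simp: A_def)

lemma zero_in_A: "0 \<in> A"
proof -
  have "x 0 \<in> x ` {..<M}"
    using M_pos by blast
  then show ?thesis
    unfolding x_0 by (simp add: A_def)
qed

lemma one_in_A: "1 \<in> A"
proof -
  have "x 0 + 1 \<in> (\<lambda>j. x j + 1) ` {..<M}"
    using M_pos by blast
  then show ?thesis
    unfolding x_0 by (simp add: A_def)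
qed

lemma finite_A: "finite A"
  by (simp add: A_def)

lemma A_separated:
  assumes "a \<in> A" "b \<in> A" "a \<noteq> b"
  shows "\<bar>a - b\<bar> \<ge> 1"
proof -
  from assms A_Nats obtain i j where "a = real i" "b = real j"
    by (meson Nats_cases subsetD)
  with assms(3) show ?thesis by auto
qed

lemma line_quadtree: "\<sigma> 0 \<in> {0..\<Phi>} \<Longrightarrow> line_quadtree \<Phi> A \<sigma>"
  by standard (use finite_A A_bounds A_separated Phi_pos in auto)

lemma ground_set_A:
  assumes "p \<ge> 1"
  shows "ground_set p 1 \<Phi> (line_point ` A)"
proof -
  let ?D = "{lp_dist p 1 x y | x y. x \<in> line_point ` A \<and> y \<in> line_point ` A \<and> x \<noteq> y}"
  have D: "?D = {\<bar>a - b\<bar> | a b. a \<in> A \<and> b \<in> A \<and> a \<noteq> b}"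
  proof (intro set_eqI iffI)
    fix z assume "z \<in> ?D"
    then obtain a b where "a \<in> A" "b \<in> A" "line_point a \<noteq> line_point b"
        "z = lp_dist p 1 (line_point a) (line_point b)"
      by blast
    then show "z \<in> {\<bar>a - b\<bar> | a b. a \<in> A \<and> b \<in> A \<and> a \<noteq> b}"
      unfolding lp_dist_line_point[OF assms] by blast
  next
    fix z assume "z \<in> {\<bar>a - b\<bar> | a b. a \<in> A \<and> b \<in> A \<and> a \<noteq> b}"
    then obtain a b where "a \<in> A" "b \<in> A" "line_point a \<noteq> line_point b"
        "z = lp_dist p 1 (line_point a) (line_point b)"
      unfolding lp_dist_line_point[OF assms] line_point_eq_iff by blast
    then show "z \<in> ?D"
      by blast
  qed
  note 01 = zero_in_A one_in_A
  have "finite ?D"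
  proof -
    have "?D \<subseteq> (\<lambda>(a, b). \<bar>a - b\<bar>) ` (A \<times> A)"
      unfolding D by auto
    then show ?thesis
      using finite_A by (meson finite_SigmaI finite_imageI finite_subset)
  qed
  moreover have "1 \<in> ?D"
    unfolding D using 01 by force
  ultimately have "Min ?D = 1"
    unfolding D by (intro Min_eqI) (use A_separated in auto)
  moreover have "line_point ` A \<subseteq> {..<1} \<rightarrow>\<^sub>E {0..\<Phi>}"
    unfolding PiE_line using A_bounds by auto
  ultimately show ?thesis
    unfolding ground_set_def using finite_A 01 by auto
qed

lemma expectation_U: "measure_pmf.expectation U f = (\<Sum>j<M. f j) / 2 ^ m" for f :: "nat \<Rightarrow> real"
  using M_pos unfolding U_def by (subst integral_pmf_of_set) (auto simp: real_M)

lemma set_U: "set_pmf U = {..<M}"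
  using M_pos unfolding U_def by (subst set_pmf_of_set) auto

lemma set_pmf_subset: "set_pmf query \<subseteq> line_point ` A" "set_pmf near \<subseteq> line_point ` A"
    "set_pmf far \<subseteq> line_point ` A"
  by (auto simp: query_def near_def far_def moved_def set_U A_def)

lemma finite_set_pmf: "finite (set_pmf query)" "finite (set_pmf near)" "finite (set_pmf far)"
  using set_pmf_subset finite_A by (meson finite_imageI finite_subset)+

section \<open>Distances in the true metric\<close>

lemma near_W1:
  assumes "p \<ge> 1"
  shows "wasserstein1 (lp_dist p 1) near query \<le> 1"
proof -
  have "wasserstein1 (lp_dist p 1) near query \<le>
      measure_pmf.expectation U (\<lambda>j. lp_dist p 1 (line_point (x j + 1)) (line_point (x j)))"
    unfolding near_def query_def by (rule wasserstein1_map_le) (simp add: lp_dist_def)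
  then show ?thesis
    by (simp add: lp_dist_line_point[OF assms])
qed

text \<open>On the line the distance is at least the difference of the means: the coordinate and its
  negative are dual potentials. Only the point \<open>0\<close> moves, by \<open>t\<close> with mass
  \<open>1 / 2 ^ m\<close>.\<close>

lemma far_W1:
  assumes "p \<ge> 1"
  shows "wasserstein1 (lp_dist p 1) far query \<ge> 2 ^ r"
proof -
  have "(\<Sum>j<M. moved j) + (\<Sum>j<M. - x j) = (\<Sum>j<M. if j = 0 then t else 0)"
    unfolding sum.distrib[symmetric] by (intro sum.cong) (auto simp: moved_def)
  also have "\<dots> = t"
    using M_pos by simp
  finally have "measure_pmf.expectation far (\<lambda>y. y 0) + measure_pmf.expectation query (\<lambda>y. - y 0) = t / 2 ^ m"
    unfolding far_def query_def integral_map_pmf expectation_U by (simp flip: add_divide_distrib)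
  then have "2 ^ r = measure_pmf.expectation far (\<lambda>y. y 0) + measure_pmf.expectation query (\<lambda>y. - y 0)"
    by (simp add: t_def power_add)
  also have "\<dots> \<le> wasserstein1 (lp_dist p 1) far query"
    by (rule wasserstein1_ge_dual[OF finite_set_pmf(3,1)])
       (auto simp: far_def query_def lp_dist_line_point[OF assms])
  finally show ?thesis .
qed

section \<open>Quadtree distances for a fixed shift\<close>

context
  fixes \<sigma> :: point
  assumes \<sigma>: "\<sigma> 0 \<in> {0..\<Phi>}"
begin

interpretation Q: line_quadtree \<Phi> A \<sigma>
  using \<sigma> by (rule line_quadtree)

text \<open>The root has side \<open>2 * \<Phi> = 2 ^ (2 * m + 2)\<close>, so depths can be
  addressed by the exponent \<open>i\<close> of the side. The bound on \<open>i\<close> keeps the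
  natural subtraction exact.\<close>

lemma side_eq: "i \<le> 2 * m + 2 \<Longrightarrow> Q.side (2 * m + 2 - i) = 2 ^ i"
proof -
  assume "i \<le> 2 * m + 2"
  then have "2 * (2::real) ^ (2 * m + 1) = 2 ^ i * 2 ^ (2 * m + 2 - i)"
    by (simp flip: power_add power_Suc)
  then show ?thesis
    unfolding Q.side_def by (simp add: \<Phi>_def field_simps)
qed

lemma cell_index_eq: "i \<le> 2 * m + 2 \<Longrightarrow> Q.cell_index (2 * m + 2 - i) y = \<lfloor>(y - Q.origin) / 2 ^ i\<rfloor>"
  unfolding Q.cell_index_def using side_eq by metis

text \<open>A cut between \<open>x j\<close> and \<open>x j + 1\<close> separates \<open>x j\<close>
  from every near point, not just from its partner. Those with \<open>i \<ge> j\<close> lie beyond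
  the cut; those with \<open>i < j\<close> lie at least \<open>2 ^ m\<close>, more than a cell, to
  the left of \<open>x j\<close>.\<close>

lemma near_cell_index_neq:
  assumes "k < m"
    and cut: "\<lfloor>(x j - Q.origin) / 2 ^ k\<rfloor> < \<lfloor>(x j + 1 - Q.origin) / 2 ^ k\<rfloor>"
  shows "\<lfloor>(x i + 1 - Q.origin) / 2 ^ k\<rfloor> \<noteq> \<lfloor>(x j - Q.origin) / 2 ^ k\<rfloor>"
proof (cases "j \<le> i")
  case True
  then have "x j \<le> x i"
    by (rule x_mono)
  then have "\<lfloor>(x j + 1 - Q.origin) / 2 ^ k\<rfloor> \<le> \<lfloor>(x i + 1 - Q.origin) / 2 ^ k\<rfloor>"
    by (intro floor_mono divide_right_mono) auto
  with cut show ?thesis by linarith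
next
  case False
  then have "Suc i \<le> j" by simp
  then have "x (Suc i) \<le> x j"
    by (rule x_mono)
  moreover have "x (Suc i) = x i + 1 + 2 ^ m"
    by (simp add: x_def algebra_simps)
  moreover have "(2::real) ^ k \<le> 2 ^ m"
    using assms(1) by (intro power_increasing) auto
  ultimately have "x i + 1 - Q.origin \<le> x j - Q.origin - 2 ^ k"
    by linarith
  then have "(x i + 1 - Q.origin) / 2 ^ k \<le> (x j - Q.origin - 2 ^ k) / 2 ^ k"
    by (intro divide_right_mono) auto
  also have "\<dots> = (x j - Q.origin) / 2 ^ k - 1"
    by (simp add: diff_divide_distrib)
  finally have "\<lfloor>(x i + 1 - Q.origin) / 2 ^ k\<rfloor> \<le> \<lfloor>(x j - Q.origin) / 2 ^ k - 1\<rfloor>"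
    by (rule floor_mono)
  then show ?thesis by simp
qed

text \<open>By duality with potential \<open>0\<close> on \<open>near\<close> and \<open>g\<close>
  on \<open>query\<close>, where \<open>g\<close> adds up the scales whose grid cuts
  \<open>x j\<close> from \<open>x j + 1\<close>. A cut at scale \<open>2 ^ k\<close> forces tree
  distance at least \<open>2 ^ k\<close> to all near points, so \<open>g\<close> is feasible; its
  mean is \<open>m / 2\<close>.\<close>

lemma near_quadtree: "wasserstein1 (quadtree_metric 1 \<Phi> (line_point ` A) \<sigma>) near query \<ge> 2 ^ (r + 3)"
proof -
  define \<delta> :: "real \<Rightarrow> nat \<Rightarrow> int" where
    "\<delta> y i = \<lfloor>(y + 1 - Q.origin) / 2 ^ i\<rfloor> - \<lfloor>(y - Q.origin) / 2 ^ i\<rfloor>" for y i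
  \<comment> \<open>The division by \<open>2\<close> absorbs the factor \<open>2\<close> of
    \<open>sum_dyadic_le\<close>.\<close>
  define g where "g y = (\<Sum>i<m. 2 ^ i * of_int (\<delta> (y 0) i)) / (2::real)" for y :: point
  have \<delta>_le: "\<delta> y i \<le> 1" for y i
  proof -
    have "(y + 1 - Q.origin) / 2 ^ i \<le> (y - Q.origin) / 2 ^ i + 1"
      by (simp add: field_simps)
    then have "\<lfloor>(y + 1 - Q.origin) / 2 ^ i\<rfloor> \<le> \<lfloor>(y - Q.origin) / 2 ^ i + 1\<rfloor>"
      by (rule floor_mono)
    then show ?thesis
      by (simp add: \<delta>_def)
  qed
  have "measure_pmf.expectation query g = (\<Sum>j<M. \<Sum>i<m. 2 ^ i * of_int (\<delta> (x j) i)) / (2 * 2 ^ m)"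
    by (simp add: query_def g_def expectation_U flip: sum_divide_distrib)
  also have "(\<Sum>j<M. \<Sum>i<m. 2 ^ i * real_of_int (\<delta> (x j) i)) = (\<Sum>i<m. 2 ^ i * of_int (\<Sum>j<M. \<delta> (x j) i))"
    by (subst sum.swap) (simp add: sum_distrib_left)
  \<comment> \<open>At each scale exactly \<open>2 ^ (m - i)\<close> pairs are cut, each weighted
    \<open>2 ^ i\<close>, so all scales contribute equally.\<close>
  also have "\<dots> = (\<Sum>i<m. 2 ^ m)"
  proof (rule sum.cong)
    fix i assume "i \<in> {..<m}"
    then have "(\<Sum>j<M. \<delta> (x j) i) = 2 ^ (m - i)" "i + (m - i) = m"
      using sum_floor_diff[of i m Q.origin] unfolding \<delta>_def x_def M_def by auto
    then show "2 ^ i * real_of_int (\<Sum>j<M. \<delta> (x j) i) = 2 ^ m"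
      by (simp flip: power_add)
  qed simp
  finally have "2 ^ (r + 3) = measure_pmf.expectation near (\<lambda>_. 0) + measure_pmf.expectation query g"
    by (simp add: m_def power_add)
  also have "\<dots> \<le> wasserstein1 (quadtree_metric 1 \<Phi> (line_point ` A) \<sigma>) near query"
  proof (rule wasserstein1_ge_dual[OF finite_set_pmf(2,1)])
    fix u v assume "u \<in> set_pmf near" "v \<in> set_pmf query"
    then obtain i j where ij: "i < M" "j < M" "u = line_point (x i + 1)" "v = line_point (x j)"
      by (auto simp: near_def query_def set_U)
    then have A: "x i + 1 \<in> A" "x j \<in> A"
      by (auto simp: A_def)
    have "2 ^ k \<le> quadtree_metric 1 \<Phi> (line_point ` A) \<sigma> u v" if "k < m" "\<delta> (x j) k > 0" for k
    proof -
      have k: "k \<le> 2 * m + 2"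
        using that by simp
      have "Q.cell_index (2 * m + 2 - k) (x i + 1) \<noteq> Q.cell_index (2 * m + 2 - k) (x j)"
        unfolding cell_index_eq[OF k] using near_cell_index_neq[of k j i] that by (simp add: \<delta>_def)
      from Q.dT_ge[OF A this] show ?thesis
        unfolding side_eq[OF k] ij .
    qed
    then have "(\<Sum>k<m. 2 ^ k * of_int (\<delta> (x j) k)) \<le> 2 * quadtree_metric 1 \<Phi> (line_point ` A) \<sigma> u v"
      by (intro sum_dyadic_le \<delta>_le Q.dT_nonneg)
    then show "0 + g v \<le> quadtree_metric 1 \<Phi> (line_point ` A) \<sigma> u v"
      by (simp add: g_def ij)
  qed
  finally show ?thesis .
qed

text \<open>Keep all points but the one moved from \<open>0\<close> to \<open>t\<close>. A common
  cell of side \<open>2 * t\<close> bounds that move by \<open>4 * t\<close> in the tree, and its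
  mass is \<open>1 / 2 ^ m\<close>.\<close>

lemma far_quadtree:
  assumes "\<lfloor>(t - Q.origin) / (2 * t)\<rfloor> = \<lfloor>(0 - Q.origin) / (2 * t)\<rfloor>"
  shows "wasserstein1 (quadtree_metric 1 \<Phi> (line_point ` A) \<sigma>) far query \<le> 2 ^ (r + 2)"
proof -
  define k where "k = 2 * m + 2 - (m + r + 1)"
  have k: "m + r + 1 \<le> 2 * m + 2" "(2::real) ^ (m + r + 1) = 2 * t"
    using r_less_m by (auto simp: t_def power_add)
  have A: "t \<in> A" "0 \<in> A"
    using zero_in_A by (auto simp: A_def)
  have "Q.cell_index k t = Q.cell_index k 0"
    unfolding k_def cell_index_eq[OF k(1)] k(2) by (rule assms)
  from Q.dT_le[OF A this] have t0: "Q.dT t 0 \<le> 4 * t"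
    unfolding k_def side_eq[OF k(1)] k(2) by simp
  have "Q.dT (moved j) (x j) \<le> (if j = 0 then 4 * t else 0)" if "j < M" for j
    using t0 Q.dT_refl[of "x j"] that by (auto simp: A_def moved_def)
  then have "(\<Sum>j<M. Q.dT (moved j) (x j)) \<le> (\<Sum>j<M. if j = 0 then 4 * t else 0)"
    by (intro sum_mono) auto
  also have "\<dots> = 4 * t"
    using M_pos by simp
  finally have "measure_pmf.expectation U (\<lambda>j. Q.dT (moved j) (x j)) \<le> 4 * t / 2 ^ m"
    unfolding expectation_U by (rule divide_right_mono) simp
  also have "\<dots> = 2 ^ (r + 2)"
    by (simp add: t_def power_add)
  finally have "measure_pmf.expectation U (\<lambda>j. Q.dT (moved j) (x j)) \<le> 2 ^ (r + 2)" .
  moreover have "wasserstein1 (quadtree_metric 1 \<Phi> (line_point ` A) \<sigma>) far query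
      \<le> measure_pmf.expectation U (\<lambda>j. Q.dT (moved j) (x j))"
    unfolding far_def query_def by (rule wasserstein1_map_le) (rule Q.dT_nonneg)
  ultimately show ?thesis
    by linarith
qed

text \<open>As \<open>\<Phi>\<close> is a multiple of \<open>2 * t\<close>, the grid of that side
  has a line at \<open>\<sigma> 0 - (i + 1) * (2 * t)\<close>. For these shifts it lies in
  \<open>(-t, 0]\<close> and the next one in \<open>(t, 2 * t]\<close>, so neither cuts
  \<open>0\<close> from \<open>t\<close>.\<close>

lemma far_quadtree_upper_half:
  assumes "\<sigma> 0 \<in> {of_nat i * (2 * t) + t <.. of_nat i * (2 * t) + 2 * t}"
  shows "wasserstein1 (quadtree_metric 1 \<Phi> (line_point ` A) \<sigma>) far query \<le> 2 ^ (r + 2)"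
proof (rule far_quadtree)
  have "\<Phi> = 2 ^ (m - r) * (2 * t)"
    using r_less_m by (simp add: \<Phi>_def t_def flip: power_add power_Suc)
  then have "Q.origin = \<sigma> 0 - 2 ^ (m - r) * (2 * t)"
    unfolding Q.origin_def by simp
  \<comment> \<open>The integer part is split off; the remainder lies in \<open>[0, 1)\<close> for
    both \<open>y = 0\<close> and \<open>y = t\<close>.\<close>
  then have *: "(y - Q.origin) / (2 * t) = of_int (2 ^ (m - r) - int i - 1) + (y + real i * (2 * t) + 2 * t - \<sigma> 0) / (2 * t)" for y
    using t_bounds(1) by (simp add: field_simps)
  have offset: "\<lfloor>(y + real i * (2 * t) + 2 * t - \<sigma> 0) / (2 * t)\<rfloor> = 0" if "y = 0 \<or> y = t" for y
    using that assms t_bounds(1) by (auto simp: floor_eq_iff field_simps)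
  then have "\<lfloor>(y - Q.origin) / (2 * t)\<rfloor> = 2 ^ (m - r) - int i - 1" if "y = 0 \<or> y = t" for y
    unfolding * int_add_floor[symmetric] using offset[OF that] by simp
  then show "\<lfloor>(t - Q.origin) / (2 * t)\<rfloor> = \<lfloor>(0 - Q.origin) / (2 * t)\<rfloor>"
    by metis
qed

end

text \<open>For shifts in \<open>B\<close> the far distribution beats the near one in the tree, so
  an answer at true distance at least \<open>2 ^ r\<close> is returned while the optimum is at most
  \<open>1\<close>. \<open>B\<close> has probability \<open>1 / 2\<close>, which leaves no success
  probability above \<open>1 / 2\<close>.\<close>

lemma quadtree_fails:
  assumes "p \<ge> 1" and tie: "\<And>S. S \<noteq> {} \<Longrightarrow> tie S \<in> S" and "n \<ge> 2" and "c < 2 ^ r"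
  shows "\<not> quadtree_guarantee tie p n c"
proof
  assume guarantee: "quadtree_guarantee tie p n c"
  \<comment> \<open>For larger \<open>n\<close> the dataset is padded with copies of
    \<open>far\<close>, so any choice other than index \<open>0\<close> is equally bad.\<close>
  define \<mu> where "\<mu> i = (if i = 0 then near else far)" for i :: nat
  let ?S = "shift_distribution 1 \<Phi>"
  let ?W = "wasserstein1 (lp_dist p 1)"
  let ?G = "{\<sigma> \<in> space ?S. approx_nearest ?W c n \<mu> query
               (quadtree_returns tie 1 \<Phi> (line_point ` A) n \<mu> query \<sigma>)}"
  define B where "B = (\<Union>i<2 ^ (m - r) :: nat. {of_nat i * (2 * t) + 2 * t / 2 <.. of_nat i * (2 * t) + 2 * t})"
  have \<Phi>_eq: "of_nat (2 ^ (m - r)) * (2 * t) = \<Phi>"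
    using r_less_m by (simp add: \<Phi>_def t_def flip: power_add power_Suc)
  have B: "B \<in> sets borel" "B \<subseteq> {0..\<Phi>}" "measure lborel B = \<Phi> / 2"
    using measure_upper_halves[of "2 * t" "2 ^ (m - r)"] t_bounds(1) unfolding B_def[symmetric] \<Phi>_eq by auto
  let ?B = "{\<sigma> \<in> space ?S. \<sigma> 0 \<in> B}"
  note S = measure_shift_distribution_1[OF Phi_pos B(1,2)]
  interpret S: prob_space ?S
    by (rule S(3))
  have fails: "\<not> approx_nearest ?W c n \<mu> query (quadtree_returns tie 1 \<Phi> (line_point ` A) n \<mu> query \<sigma>)"
    if "\<sigma> 0 \<in> B" for \<sigma>
  proof -
    let ?T = "wasserstein1 (quadtree_metric 1 \<Phi> (line_point ` A) \<sigma>)"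
    have \<sigma>: "\<sigma> 0 \<in> {0..\<Phi>}"
      using that B(2) by blast
    have "?T far query \<le> 2 ^ (r + 2)"
      using that far_quadtree_upper_half[of \<sigma>, OF \<sigma>] by (auto simp: B_def)
    also have "\<dots> < (2::real) ^ (r + 3)"
      by (simp add: power_add)
    also have "\<dots> \<le> ?T near query"
      by (rule near_quadtree[of \<sigma>, OF \<sigma>])
    finally have less: "?T far query < ?T near query" .
    then have "1 \<in> nearest ?T n \<mu> query"
      using \<open>n \<ge> 2\<close> by (auto simp: nearest_def \<mu>_def)
    then have "tie (nearest ?T n \<mu> query) \<in> nearest ?T n \<mu> query"
      using tie by blast
    moreover have "0 \<notin> nearest ?T n \<mu> query"
      using less \<open>n \<ge> 2\<close> by (auto simp: nearest_def \<mu>_def not_le intro!: exI[of _ 1])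
    ultimately have "quadtree_returns tie 1 \<Phi> (line_point ` A) n \<mu> query \<sigma> \<noteq> 0"
      unfolding quadtree_returns_def by metis
    then have returns: "?W (\<mu> (quadtree_returns tie 1 \<Phi> (line_point ` A) n \<mu> query \<sigma>)) query \<ge> 2 ^ r"
      using far_W1[OF assms(1)] by (simp add: \<mu>_def)
    let ?Min = "Min ((\<lambda>j. ?W (\<mu> j) query) ` {..<n})"
    have "?Min \<le> ?W (\<mu> 0) query"
      using \<open>n \<ge> 2\<close> by (intro Min_le) auto
    then have "?Min \<le> 1"
      using near_W1[OF assms(1)] by (simp add: \<mu>_def)
    moreover have "?W \<rho> \<rho>' \<ge> 0" for \<rho> \<rho>'
      by (rule wasserstein1_nonneg) (simp add: lp_dist_def)
    then have "?Min \<ge> 0"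
      using \<open>n \<ge> 2\<close> by (subst Min_ge_iff) (auto simp: lessThan_empty_iff)
    \<comment> \<open>The factor \<open>c\<close> may be negative; \<open>max c 0\<close> keeps the
      product monotone.\<close>
    ultimately have "c * ?Min \<le> max c 0 * 1"
      by (intro mult_mono) auto
    also have "\<dots> < 2 ^ r"
      using \<open>c < 2 ^ r\<close> by simp
    finally have "c * ?Min < 2 ^ r" .
    with returns show ?thesis
      by (simp add: approx_nearest_def)
  qed
  then have "?G \<subseteq> space ?S - ?B"
    by blast
  \<comment> \<open>Monotonicity asks for measurability of the larger set; a nonmeasurable
    \<open>?G\<close> would have measure \<open>0\<close> by default.\<close>
  then have "measure ?S ?G \<le> measure ?S (space ?S - ?B)"
    using S(2) by (intro S.finite_measure_mono) auto
  also have "\<dots> = 1 / 2"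
    using S.prob_compl[OF S(2)] S(1) B(3) Phi_pos by simp
  finally have "measure ?S ?G \<le> 1 / 2" .
  moreover have "measure ?S ?G > 1 / 2"
    using guarantee ground_set_A[OF assms(1)] Phi_pos set_pmf_subset
    unfolding quadtree_guarantee_def \<mu>_def by auto
  ultimately show False by linarith
qed

end

text \<open>The guarantee ranges over all \<open>\<Phi>\<close> and ground sets, so for a fixed
  \<open>n\<close> the instance can grow with \<open>r\<close> until \<open>2 ^ r\<close> exceeds
  \<open>c\<close>.\<close>

lemma no_quadtree_guarantee:
  fixes c p :: real
  assumes "p \<ge> 1" "\<And>S. S \<noteq> {} \<Longrightarrow> tie S \<in> S" "n \<ge> 2"
  shows "\<not> quadtree_guarantee tie p n c"
proof -
  obtain r where "c < 2 ^ r"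
    using real_arch_pow[of 2 c] by auto
  with assms show ?thesis
    by (rule hard_instance.quadtree_fails)
qed

theorem theorem3p3:
  fixes c :: "nat \<Rightarrow> real" and p :: real and tie :: "nat set \<Rightarrow> nat"
  assumes "p \<ge> 1"
    and "\<And>S. S \<noteq> {} \<Longrightarrow> tie S \<in> S"
    and "eventually (\<lambda>n. quadtree_guarantee tie p n (c n)) sequentially"
  shows "c \<in> \<Omega>(\<lambda>n. ln (real n))"
proof -
  \<comment> \<open>From \<open>n = 2\<close> on no factor is guaranteed, so the assumed guarantee
    is contradictory and the bound follows vacuously.\<close>
  have "eventually (\<lambda>n. False) sequentially"
    using assms(3) eventually_ge_at_top[of 2]
    by eventually_elim (use no_quadtree_guarantee[OF assms(1,2)] in blast)
  then have False
    by (simp add: eventually_False)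
  then show ?thesis ..
qed

end
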